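(* Let $G=(V,E)$ be a complete directed graph with $|V|\ge2$ (both arcs $(u,v)$ and $(v,u)$ present for all distinct $u,v\in V$), and let $w:2^E\to\mathbb{R}_{\ge0}$ be a monotone submodular function with curvature $\kappa\in[0,1]$. The directed greedy tour algorithm (defined in the context) is a $\frac{1}{3+\kappa}$-approximation: its output $M$ is a directed Hamiltonian cycle of $G$ with $$w(M)\ \ge\ \frac{1}{3+\kappa}\ \max_{S\in\mathcal{H}}w(S),$$ where $\mathcal{H}$ is the set of (arc sets of) all directed Hamiltonian cycles of $G$.
   Context: A function $w$ is submodular if $w(S)+w(T)\ge w(S\cup T)+w(S\cap T)$ for all $S,T\subseteq E$, and monotone if $A\subseteq B$ implies $w(A)\le w(B)$. Write $\Delta_A(e)=w(A\cup\{e\})-w(A)$. The function $w$ has curvature $\kappa\in[0,1]$ if $\Delta_A(e)\ge(1-\kappa)w(\{e\})$ for every $A\subset E$, $e\in E\setminus A$. Directed greedy tour algorithm: start with $M=\emptyset$ and candidate set $E$. While the candidate set is nonempty and $|M|<|V|$: let $e_m=(u,v)$ be a candidate arc maximizing $\Delta_M(e)$. Add $e_m$ to $M$ if the out-degree of $u$ and the in-degree of $v$ in $(V,M)$ are both less than $1$ and adding $e_m$ does not create a directed cycle that is not Hamiltonian. In either case remove $e_m$ from the candidate set. Output $M$. *)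

theory Defs
  imports Complex_Main "Graph_Theory.Graph_Theory"
begin

text \<open>Set functions on \<open>2^E\<close> are total functions on \<^typ>\<open>'b set\<close>; all conditions refer
  only to subsets of the ground set \<open>E\<close>. Monotonicity is \<open>mono_on (Pow E) w\<close>. Neither here nor
  in the theorem is \<open>w {} = 0\<close> required.\<close>

definition submodular_on :: "'b set \<Rightarrow> ('b set \<Rightarrow> real) \<Rightarrow> bool" where
  "submodular_on E w \<longleftrightarrow>
     (\<forall>S T. S \<subseteq> E \<longrightarrow> T \<subseteq> E \<longrightarrow> w S + w T \<ge> w (S \<union> T) + w (S \<inter> T))"

definition marginal :: "('b set \<Rightarrow> real) \<Rightarrow> 'b set \<Rightarrow> 'b \<Rightarrow> real" where
  "marginal w A e = w (A \<union> {e}) - w A"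

definition has_curvature_on :: "'b set \<Rightarrow> ('b set \<Rightarrow> real) \<Rightarrow> real \<Rightarrow> bool" where
  "has_curvature_on E w \<kappa> \<longleftrightarrow>
     (\<forall>A e. A \<subseteq> E \<longrightarrow> e \<in> E - A \<longrightarrow> marginal w A e \<ge> (1 - \<kappa>) * w {e})"

text \<open>A cycle in the sense of \<open>pre_digraph.cycle\<close> is a nonempty closed arc walk without repeated
  vertices. Every vertex of such a walk is the tail of one of its arcs. In a two-vertex complete
  digraph, the two antiparallel arcs form a cycle.\<close>

definition hamiltonian_cycle :: "('a, 'b) pre_digraph \<Rightarrow> 'b list \<Rightarrow> bool" where
  "hamiltonian_cycle G p \<longleftrightarrow> pre_digraph.cycle G p \<and> tail G ` set p = verts G"

definition hamiltonian_cycles :: "('a, 'b) pre_digraph \<Rightarrow> 'b set set" where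
  "hamiltonian_cycles G = {set p | p. hamiltonian_cycle G p}"

text \<open>The subgraph \<open>(V, M)\<close> of \<open>G = (V, E)\<close>.\<close>

abbreviation with_arcs :: "('a, 'b) pre_digraph \<Rightarrow> 'b set \<Rightarrow> ('a, 'b) pre_digraph" where
  "with_arcs G M \<equiv> G\<lparr>arcs := M\<rparr>"

definition tour_extendable :: "('a, 'b) pre_digraph \<Rightarrow> 'b set \<Rightarrow> 'b \<Rightarrow> bool" where
  "tour_extendable G M e \<longleftrightarrow>
     out_degree (with_arcs G M) (tail G e) < 1 \<and>
     in_degree (with_arcs G M) (head G e) < 1 \<and>
     \<not> (\<exists>p. pre_digraph.cycle (with_arcs G (M \<union> {e})) p \<and> e \<in> set p \<and>
            \<not> hamiltonian_cycle (with_arcs G (M \<union> {e})) p)"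

definition greedy_running :: "('a, 'b) pre_digraph \<Rightarrow> 'b set \<Rightarrow> 'b set \<Rightarrow> bool" where
  "greedy_running G M C \<longleftrightarrow> C \<noteq> {} \<and> card M < card (verts G)"

text \<open>\<open>greedy_state G w M C\<close>: some run of the algorithm reaches partial solution \<open>M\<close> with
  candidate set \<open>C\<close>. The relation is nondeterministic because ties between maximizing candidates
  may be broken arbitrarily.\<close>

inductive greedy_state ::
  "('a, 'b) pre_digraph \<Rightarrow> ('b set \<Rightarrow> real) \<Rightarrow> 'b set \<Rightarrow> 'b set \<Rightarrow> bool"
  for G :: "('a, 'b) pre_digraph" and w :: "'b set \<Rightarrow> real" where
  init: "greedy_state G w {} (arcs G)"
| step: "greedy_state G w M C \<Longrightarrow> greedy_running G M C \<Longrightarrow>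
    is_arg_max (marginal w M) (\<lambda>e. e \<in> C) e \<Longrightarrow>
    greedy_state G w (if tour_extendable G M e then M \<union> {e} else M) (C - {e})"

definition greedy_output :: "('a, 'b) pre_digraph \<Rightarrow> ('b set \<Rightarrow> real) \<Rightarrow> 'b set \<Rightarrow> bool" where
  "greedy_output G w M \<longleftrightarrow> (\<exists>C. greedy_state G w M C \<and> \<not> greedy_running G M C)"

text \<open>Every step shrinks the finite candidate set, so every run terminates, and no run gets stuck:
  any reachable state leads to an output. In particular, quantifying over all outputs is not
  vacuous.\<close>

lemma greedy_output_exists:
  assumes "finite (arcs G)"
  shows "\<exists>M. greedy_output G w M"
proof -
  have "\<exists>M'. greedy_output G w M'" if "greedy_state G w M C" "finite C" for M C
    using that
  proof (induction "card C" arbitrary: M C rule: less_induct)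
    case less
    show ?case
    proof (cases "greedy_running G M C")
      case False
      then show ?thesis using less.prems unfolding greedy_output_def by blast
    next
      case True
      then have "C \<noteq> {}" by (simp add: greedy_running_def)
      with less.prems(2) have "Max (marginal w M ` C) \<in> marginal w M ` C" by simp
      then obtain e where e: "e \<in> C" "marginal w M e = Max (marginal w M ` C)" by auto
      have "is_arg_max (marginal w M) (\<lambda>e. e \<in> C) e"
        using e less.prems(2) by (auto simp: is_arg_max_def not_less)
      from step[OF less.prems(1) True this]
      show ?thesis
        by (rule less.hyps[rotated]) (use e less.prems(2) in \<open>auto intro: card_Diff1_less simp del: card_Diff_singleton card_Diff_insert\<close>)
    qed
  qed
  then show ?thesis using init assms by blast
qed

end

theory Submission
  imports Defs
begin

text \<open>Call a set of arcs a \<^emph>\<open>partial tour\<close> if no two of its arcs share a tail or a head and each of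
  its cycles is Hamiltonian. The greedy algorithm maintains a partial tour \<open>M\<close>.

  \<^emph>\<open>The output is a Hamiltonian cycle.\<close> As long as \<open>M\<close> has fewer arcs than there are vertices, it
  has a vertex \<open>x\<close> without outgoing arc and a vertex \<open>y\<close> without incoming arc, and such a pair can be
  chosen so that the arc \<open>(x, y)\<close> is extendable (\<open>maximal_partial_tour_card\<close>). An arc that was
  discarded never becomes extendable again, so the candidates cannot run out before \<open>M\<close> has
  as many arcs as there are vertices; such a partial tour is a Hamiltonian cycle
  (\<open>full_partial_tour_hamiltonian\<close>).

  \<^emph>\<open>The approximation ratio.\<close> Fix a Hamiltonian cycle \<open>S\<close>. Adding an arc \<open>e\<close> to \<open>M\<close> blocks at most
  three arcs of \<open>S\<close> that could still have been added before: the one with the tail of \<open>e\<close>, the one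
  with the head of \<open>e\<close>, and the one that closes the path of \<open>M\<close> through \<open>e\<close>. If \<open>e\<close> itself lies in
  \<open>S\<close>, the first two are \<open>e\<close>, and only the third is lost. The newly blocked arcs were still
  candidates, so by the greedy choice each has at most the marginal value of \<open>e\<close>. Hence, with
  \<open>\<rho>\<close> the marginal value of \<open>e\<close> when it is added, the potential
  \[ w(M) + \sum_{s \in S - M\ \mathrm{blocked}} \Delta_M(s) + w(S) - w(S \cup M) \]
  grows by at most \<open>\<rho> + 3\<rho> - (1 - \<kappa>)\<rho>\<close> if \<open>e\<close> is not in \<open>S\<close>, where the curvature bounds the growth of
  \<open>w (S \<union> M)\<close> from below, and by at most \<open>\<rho> + \<rho>\<close> otherwise. So it never exceeds
  \<open>(3 + \<kappa>) w(M)\<close> (\<open>greedy_potential\<close>). At the end all of \<open>S - M\<close> is blocked, and submodularity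
  shows that the potential is at least \<open>w(S)\<close>.\<close>

section \<open>Submodular functions\<close>

lemma marginal_nonneg:
  assumes "mono_on (Pow E) w" "A \<subseteq> E" "e \<in> E"
  shows "0 \<le> marginal w A e"
  using mono_onD[OF assms(1), of A "A \<union> {e}"] assms(2,3) by (auto simp: marginal_def)

lemma marginal_antimono:
  assumes "mono_on (Pow E) w" "submodular_on E w" "A \<subseteq> B" "B \<subseteq> E" "e \<in> E"
  shows "marginal w B e \<le> marginal w A e"
proof (cases "e \<in> B")
  case True
  then have "marginal w B e = 0" by (simp add: marginal_def insert_absorb)
  then show ?thesis using marginal_nonneg[OF assms(1), of A e] assms by auto
next
  case False
  then have "(A \<union> {e}) \<union> B = B \<union> {e}" "(A \<union> {e}) \<inter> B = A" using assms(3) by auto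
  moreover have "w (A \<union> {e}) + w B \<ge> w ((A \<union> {e}) \<union> B) + w ((A \<union> {e}) \<inter> B)"
    using assms(2)[unfolded submodular_on_def, rule_format, of "A \<union> {e}" B] assms(3-5) by blast
  ultimately show ?thesis by (simp add: marginal_def)
qed

lemma submodular_union_le:
  assumes "mono_on (Pow E) w" "submodular_on E w" "A \<subseteq> E" "finite B" "B \<subseteq> E"
  shows "w (A \<union> B) \<le> w A + (\<Sum>b\<in>B. marginal w A b)"
  using assms(4,5)
proof (induction B)
  case (insert b B)
  have "w (A \<union> insert b B) = w (A \<union> B) + marginal w (A \<union> B) b"
    by (simp add: marginal_def)
  moreover have "marginal w (A \<union> B) b \<le> marginal w A b"
    using insert.prems assms(3) by (intro marginal_antimono[OF assms(1,2)]) auto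
  ultimately show ?case using insert by simp
qed simp

section \<open>Cycles within an arc set\<close>

lemma pre_cas_with_arcs: "pre_digraph.cas (with_arcs G A) u p v = pre_digraph.cas G u p v"
  by (induction p arbitrary: u) (simp_all add: pre_digraph.cas.simps)

lemma pre_awalk_verts_with_arcs:
  "pre_digraph.awalk_verts (with_arcs G A) u p = pre_digraph.awalk_verts G u p"
  by (induction p arbitrary: u) (simp_all add: pre_digraph.awalk_verts.simps)

lemma cycle_with_arcs_iff:
  assumes "A \<subseteq> arcs G"
  shows "pre_digraph.cycle (with_arcs G A) p \<longleftrightarrow> pre_digraph.cycle G p \<and> set p \<subseteq> A"
  using assms
  by (auto simp: pre_digraph.cycle_def pre_digraph.awalk_def pre_cas_with_arcs
      pre_awalk_verts_with_arcs)

lemma (in pre_digraph) cas_imp_rtrancl: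
  assumes "cas u p v" "set p \<subseteq> A"
  shows "(u, v) \<in> (arcs_ends (with_arcs G A))\<^sup>*"
  using assms
proof (induction p arbitrary: u)
  case (Cons a p)
  then have "(u, head G a) \<in> arcs_ends (with_arcs G A)"
    by (auto simp: arcs_ends_def arc_to_ends_def)
  moreover have "(head G a, v) \<in> (arcs_ends (with_arcs G A))\<^sup>*" using Cons by simp
  ultimately show ?case by (rule converse_rtrancl_into_rtrancl)
qed simp

context digraph
begin

lemma cycle_inj:
  assumes "cycle p"
  shows "inj_on (tail G) (set p)" "inj_on (head G) (set p)" "tail G ` set p = head G ` set p"
proof -
  from assms obtain u where u: "awalk u p u" "distinct (tl (awalk_verts u p))" "p \<noteq> []"
    by (auto simp: cycle_def)
  then have c: "cas u p u" by (auto simp: awalk_def)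
  have tl: "tl (awalk_verts u p) = map (head G) p"
    using awalk_verts_conv'[OF c] u(3) by simp
  with u(2) show "inj_on (head G) (set p)" by (simp add: distinct_map)
  \<comment> \<open>The tails are the heads, rotated by one position.\<close>
  have "awalk_verts u p = map (tail G) p @ [u]" "awalk_verts u p = u # map (head G) p"
    using awalk_verts_conv[of u p] awalk_verts_conv'[OF c] u(1,3) awhd_if_cas[OF c] awlast_if_cas[OF c]
    by (auto simp: hd_map)
  then have "mset (map (tail G) p) + {#u#} = {#u#} + mset (map (head G) p)"
    by (metis mset.simps(2) mset_append add_mset_add_single mset_single_iff union_commute)
  then have m: "mset (map (tail G) p) = mset (map (head G) p)" by (metis add.commute add_right_imp_eq)
  from u(2) tl have "distinct (map (tail G) p)" using mset_eq_imp_distinct_iff[OF m] by simp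
  then show "inj_on (tail G) (set p)" by (simp add: distinct_map)
  show "tail G ` set p = head G ` set p" using mset_eq_setD[OF m] by simp
qed

lemma cycle_arcs: "cycle p \<Longrightarrow> set p \<subseteq> arcs G"
  by (auto simp: cycle_def awalk_def)

lemma cycle_rest_connects:
  assumes "cycle p" "e \<in> set p" "set p \<subseteq> insert e A"
  shows "(head G e, tail G e) \<in> (arcs_ends (with_arcs G A))\<^sup>*"
proof -
  from assms(1) obtain u where u: "awalk u p u" "distinct p"
    by (auto simp: cycle_conv)
  from assms(2) obtain q r where p: "p = q @ e # r" by (meson split_list)
  have "cas u q (tail G e)" "cas (head G e) r u"
    using u(1) by (auto simp: awalk_def p)
  moreover have "set q \<subseteq> A" "set r \<subseteq> A" using assms(3) u(2) by (auto simp: p)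
  ultimately show ?thesis using cas_imp_rtrancl[of "head G e" r u A] cas_imp_rtrancl[of u q _ A]
    by (meson rtrancl_trans)
qed

text \<open>Following outgoing arcs inside the finite set \<open>Z\<close> must eventually repeat a vertex; formally, an
  acyclic relation on a finite set is well-founded, so it would have a sink in \<open>Z\<close>.\<close>

lemma closed_set_cycle:
  assumes M: "M \<subseteq> arcs G" and "Z \<noteq> {}"
    and step: "\<And>z. z \<in> Z \<Longrightarrow> \<exists>a\<in>M. tail G a = z \<and> head G a \<in> Z"
  shows "\<exists>p. cycle p \<and> set p \<subseteq> M \<and> tail G ` set p \<subseteq> Z"
proof -
  define A where "A = {a \<in> M. tail G a \<in> Z \<and> head G a \<in> Z}"
  have A: "A \<subseteq> arcs G" using M by (auto simp: A_def)
  interpret H: fin_digraph "with_arcs G A"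
    using A finite_subset[OF A] by unfold_locales auto
  define R where "R = arcs_ends (with_arcs G A)"
  have R: "(x, y) \<in> R \<longleftrightarrow> (\<exists>a\<in>A. tail G a = x \<and> head G a = y)" for x y
    by (auto simp: R_def arcs_ends_def arc_to_ends_def)
  have "\<not> acyclic R"
  proof
    assume "acyclic R"
    moreover have "finite R" unfolding R_def arcs_ends_def using H.finite_arcs by blast
    ultimately have "wf (R\<inverse>)" by (simp add: finite_acyclic_wf_converse)
    then obtain z where z: "z \<in> Z" "\<And>y. (y, z) \<in> R\<inverse> \<Longrightarrow> y \<notin> Z"
      using \<open>Z \<noteq> {}\<close> by (metis wfE_min ex_in_conv)
    obtain a where a: "a \<in> M" "tail G a = z" "head G a \<in> Z" using step[OF z(1)] by auto
    then have "(z, head G a) \<in> R" unfolding R using z(1) by (auto simp: A_def)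
    then show False using z(2)[of "head G a"] a(3) by simp
  qed
  then obtain z where "(z, z) \<in> R\<^sup>+" by (auto simp: acyclic_def)
  then obtain p where "H.awalk z p z" "p \<noteq> []"
    using H.reachable1_awalk unfolding R_def by blast
  then have "H.closed_w p" by (auto simp: H.closed_w_def)
  then obtain c where "H.cycle c" using H.closed_w_imp_cycle by blast
  then have "cycle c" "set c \<subseteq> A" using cycle_with_arcs_iff[OF A] by auto
  then show ?thesis by (auto simp: A_def)
qed

lemma unique_reachable_sink:
  assumes "inj_on (tail G) M" "x \<notin> tail G ` M" "y \<notin> tail G ` M"
    and "(u, x) \<in> (arcs_ends (with_arcs G M))\<^sup>*" "(u, y) \<in> (arcs_ends (with_arcs G M))\<^sup>*"
  shows "x = y"
proof -
  let ?R = "arcs_ends (with_arcs G M)"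
  have "single_valued ?R"
    using assms(1) by (auto simp: single_valued_def arcs_ends_def arc_to_ends_def inj_on_def)
  then have "(x, y) \<in> ?R\<^sup>* \<or> (y, x) \<in> ?R\<^sup>*"
    using assms(4,5) by (rule single_valued_confluent)
  moreover have "(x, z) \<notin> ?R" "(y, z) \<notin> ?R" for z
    using assms(2,3) by (auto simp: arcs_ends_def arc_to_ends_def)
  ultimately show ?thesis by (metis converse_rtranclE)
qed

section \<open>Partial tours\<close>

definition partial_tour :: "'b set \<Rightarrow> bool" where
  "partial_tour M \<longleftrightarrow> M \<subseteq> arcs G \<and> inj_on (tail G) M \<and> inj_on (head G) M \<and>
     (\<forall>p. cycle p \<longrightarrow> set p \<subseteq> M \<longrightarrow> tail G ` set p = verts G)"

lemma tour_extendable_iff: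
  assumes "M \<subseteq> arcs G" "e \<in> arcs G"
  shows "tour_extendable G M e \<longleftrightarrow>
    tail G e \<notin> tail G ` M \<and> head G e \<notin> head G ` M \<and>
    (\<forall>p. cycle p \<longrightarrow> set p \<subseteq> insert e M \<longrightarrow> e \<in> set p \<longrightarrow> tail G ` set p = verts G)"
proof -
  have "finite M" using assms(1) by (rule finite_subset) simp
  then have "out_degree (with_arcs G M) v < 1 \<longleftrightarrow> v \<notin> tail G ` M"
    "in_degree (with_arcs G M) v < 1 \<longleftrightarrow> v \<notin> head G ` M" for v
    by (auto simp: out_degree_def in_degree_def out_arcs_def in_arcs_def)
  moreover have "insert e M \<subseteq> arcs G" using assms by auto
  ultimately show ?thesis
    unfolding tour_extendable_def hamiltonian_cycle_def by (simp add: cycle_with_arcs_iff) blast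
qed

lemma tour_extendable_antimono:
  assumes "M \<subseteq> N" "N \<subseteq> arcs G" "e \<in> arcs G" "tour_extendable G N e"
  shows "tour_extendable G M e"
proof -
  have "M \<subseteq> arcs G" using assms(1,2) by auto
  moreover have "insert e M \<subseteq> insert e N" using assms(1) by auto
  ultimately show ?thesis
    using assms(1,4) unfolding tour_extendable_iff[OF \<open>M \<subseteq> arcs G\<close> assms(3)]
      tour_extendable_iff[OF assms(2,3)] by (meson image_mono subset_iff order_trans)
qed

lemma partial_tour_insert:
  assumes "partial_tour M" "e \<in> arcs G" "tour_extendable G M e"
  shows "partial_tour (insert e M)"
proof -
  have M: "M \<subseteq> arcs G" using assms(1) by (simp add: partial_tour_def)
  have "tail G ` set p = verts G" if "cycle p" "set p \<subseteq> insert e M" for p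
  proof (cases "e \<in> set p")
    case True
    then show ?thesis using that assms(3) tour_extendable_iff[OF M assms(2)] by auto
  next
    case False
    then show ?thesis using that assms(1) by (auto simp: partial_tour_def)
  qed
  then show ?thesis
    using assms tour_extendable_iff[OF M assms(2)] by (auto simp: partial_tour_def)
qed

lemma hamiltonian_cycle_not_extendable:
  assumes "M \<in> hamiltonian_cycles G" "e \<in> arcs G"
  shows "\<not> tour_extendable G M e"
proof -
  have "M \<subseteq> arcs G" "tail G ` M = verts G"
    using assms(1) cycle_arcs by (auto simp: hamiltonian_cycles_def hamiltonian_cycle_def)
  then show ?thesis using tour_extendable_iff assms(2) by auto
qed

lemma full_partial_tour_hamiltonian:
  assumes "partial_tour M" "card (verts G) \<le> card M" "verts G \<noteq> {}"
  shows "M \<in> hamiltonian_cycles G"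
proof -
  have M: "M \<subseteq> arcs G" "inj_on (tail G) M" using assms(1) by (auto simp: partial_tour_def)
  have "tail G ` M = verts G"
    using M assms(2) by (intro card_seteq) (auto simp: card_image)
  then have "\<exists>a\<in>M. tail G a = z \<and> head G a \<in> verts G" if "z \<in> verts G" for z
    using that M(1) by (metis head_in_verts imageE subsetD)
  then obtain p where p: "cycle p" "set p \<subseteq> M"
    using closed_set_cycle[OF M(1) assms(3)] by blast
  then have t: "tail G ` set p = verts G" using assms(1) by (auto simp: partial_tour_def)
  then have "set p = M"
    using inj_on_image_eq_iff[OF M(2) p(2) subset_refl] \<open>tail G ` M = verts G\<close> by simp
  then show ?thesis using p t by (auto simp: hamiltonian_cycles_def hamiltonian_cycle_def)
qed

text \<open>If \<open>M\<close> is smaller, there are a vertex \<open>x\<close> without outgoing and a vertex \<open>y\<close> without incoming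
  arc. If \<open>x \<noteq> y\<close>, then adding \<open>(x, y)\<close> closes a cycle that misses some vertex. If every missed
  vertex had an outgoing arc, these arcs would stay among the missed vertices and form a
  non-Hamiltonian cycle of \<open>M\<close>; so a missed vertex \<open>x'\<close> has none. Then \<open>(x', y)\<close> closes a cycle as
  well, but the path of \<open>M\<close> that starts in \<open>y\<close> cannot end both in \<open>x\<close> and in \<open>x'\<close>. If no such pair
  with \<open>x \<noteq> y\<close> exists, all vertices but one isolated vertex lie on cycles of \<open>M\<close>, and none of these
  is Hamiltonian.\<close>

lemma maximal_partial_tour_card:
  assumes complete: "arcs_ends G = {(u, v). (u, v) \<in> verts G \<times> verts G \<and> u \<noteq> v}"
    and two: "2 \<le> card (verts G)"
    and M: "partial_tour M"
    and maximal: "\<And>e. e \<in> arcs G \<Longrightarrow> \<not> tour_extendable G M e"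
  shows "card (verts G) \<le> card M"
proof (rule ccontr)
  assume "\<not> card (verts G) \<le> card M"
  then have less: "card M < card (verts G)" by simp
  have MG: "M \<subseteq> arcs G" and inj: "inj_on (tail G) M" "inj_on (head G) M"
    and ham: "\<And>p. cycle p \<Longrightarrow> set p \<subseteq> M \<Longrightarrow> tail G ` set p = verts G"
    using M by (auto simp: partial_tour_def)
  have no_cycle: False
    if "Z \<noteq> {}" "x \<in> verts G" "x \<notin> tail G ` M"
      "\<And>z. z \<in> Z \<Longrightarrow> \<exists>a\<in>M. tail G a = z \<and> head G a \<in> Z" for x Z
    using closed_set_cycle[OF MG that(1,4)] ham that(2,3) by blast
  have closing: "\<exists>e p. tail G e = x \<and> head G e = y \<and> cycle p \<and> e \<in> set p \<and> set p \<subseteq> insert e M \<and>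
      tail G ` set p \<noteq> verts G"
    if "x \<in> verts G" "y \<in> verts G" "x \<noteq> y" "x \<notin> tail G ` M" "y \<notin> head G ` M" for x y
  proof -
    have "(x, y) \<in> arcs_ends G" using that complete by simp
    then obtain e where "e \<in> arcs G" "tail G e = x" "head G e = y"
      by (auto simp: arcs_ends_def arc_to_ends_def)
    then show ?thesis using maximal[of e] that(4,5) tour_extendable_iff[OF MG] by metis
  qed
  have distinct_ends: False
    if xy: "x \<in> verts G" "y \<in> verts G" "x \<noteq> y" "x \<notin> tail G ` M" "y \<notin> head G ` M" for x y
  proof -
    obtain e p where e: "tail G e = x" "head G e = y"
      and p: "cycle p" "e \<in> set p" "set p \<subseteq> insert e M" "tail G ` set p \<noteq> verts G"
      using closing[OF xy] by auto
    note heads = cycle_inj(3)[OF p(1)]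
    have yx: "(y, x) \<in> (arcs_ends (with_arcs G M))\<^sup>*"
      using cycle_rest_connects[OF p(1-3)] e by simp
    define Z where "Z = verts G - tail G ` set p"
    have "tail G ` set p \<subseteq> verts G" using cycle_arcs[OF p(1)] by auto
    then have "Z \<noteq> {}" using p(4) by (auto simp: Z_def)
    have out: "z \<in> tail G ` M" if "z \<in> Z" for z
    proof (rule ccontr)
      assume z: "z \<notin> tail G ` M"
      have "x \<in> tail G ` set p" "y \<in> tail G ` set p" using p(2) e heads by auto
      then have "z \<noteq> y" "z \<noteq> x" "z \<in> verts G" using that by (auto simp: Z_def)
      then obtain e' p' where "tail G e' = z" "head G e' = y"
        "cycle p'" "e' \<in> set p'" "set p' \<subseteq> insert e' M"
        using closing[OF _ xy(2) _ z xy(5)] by auto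
      then have "(y, z) \<in> (arcs_ends (with_arcs G M))\<^sup>*" using cycle_rest_connects by blast
      with yx have "x = z" using unique_reachable_sink[OF inj(1) xy(4) z] by simp
      with \<open>z \<noteq> x\<close> show False by simp
    qed
    have "\<exists>a\<in>M. tail G a = z \<and> head G a \<in> Z" if z: "z \<in> Z" for z
    proof -
      obtain a where a: "a \<in> M" "tail G a = z" using out[OF z] by auto
      have "head G a \<notin> tail G ` set p"
      proof
        assume "head G a \<in> tail G ` set p"
        then obtain b where b: "b \<in> set p" "head G b = head G a" using heads by auto
        then have "b \<noteq> e" using e(2) xy(5) a(1) by auto
        then have "b = a" using b p(3) a(1) inj(2) by (auto simp: inj_on_def)
        then show False using b(1) a(2) z by (auto simp: Z_def)
      qed
      then have "head G a \<in> Z" using a(1) MG by (auto simp: Z_def)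
      then show ?thesis using a by auto
    qed
    then show False by (rule no_cycle[OF \<open>Z \<noteq> {}\<close> xy(1,4)])
  qed
  have "card (tail G ` M) < card (verts G)" "card (head G ` M) < card (verts G)"
    using less inj by (auto simp: card_image)
  then have "\<not> verts G \<subseteq> tail G ` M" "\<not> verts G \<subseteq> head G ` M"
    using MG by (metis card_mono finite_arcs finite_imageI finite_subset linorder_not_less)+
  then obtain x y where x: "x \<in> verts G" "x \<notin> tail G ` M" and y: "y \<in> verts G" "y \<notin> head G ` M"
    by auto
  have "y = x" using distinct_ends[OF x(1) y(1) _ x(2) y(2)] by auto
  have "z \<in> tail G ` M" if "z \<in> verts G - {x}" for z
    using distinct_ends[of z x] that y \<open>y = x\<close> by auto
  then have step: "\<exists>a\<in>M. tail G a = z \<and> head G a \<in> verts G - {x}" if "z \<in> verts G - {x}" for z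
    using that y(2) MG \<open>y = x\<close> by force
  have "verts G - {x} \<noteq> {}"
  proof
    assume "verts G - {x} = {}"
    then have "verts G \<subseteq> {x}" by auto
    then have "card (verts G) \<le> 1" using card_mono[of "{x}" "verts G"] by simp
    then show False using two by simp
  qed
  then show False by (rule no_cycle[OF _ x step])
qed

text \<open>The arcs of \<open>S\<close> that become unextendable by the addition of \<open>e\<close> share its tail, share its
  head, or close a cycle through \<open>e\<close>. For the last kind, following \<open>M\<close> from the head of \<open>e\<close> leads to
  the tail of the arc, a vertex without outgoing arc; so this tail, and hence the arc, is unique.\<close>

lemma card_newly_blocked:
  assumes M': "partial_tour (insert e M)"
    and S: "S \<subseteq> arcs G" "inj_on (tail G) S" "inj_on (head G) S"
  defines "N \<equiv> {s \<in> S - insert e M. tour_extendable G M s \<and> \<not> tour_extendable G (insert e M) s}"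
  shows "card N \<le> 3" and "e \<in> S \<Longrightarrow> card N \<le> 1"
proof -
  let ?M' = "insert e M"
  have MG: "M \<subseteq> arcs G" "?M' \<subseteq> arcs G" and inj: "inj_on (tail G) ?M'"
    using M' by (auto simp: partial_tour_def)
  define A where "A = {s \<in> S - {e}. tail G s = tail G e}"
  define B where "B = {s \<in> S - {e}. head G s = head G e}"
  define C where "C = {s \<in> S. tail G s \<notin> tail G ` ?M' \<and>
    (head G e, tail G s) \<in> (arcs_ends (with_arcs G ?M'))\<^sup>*}"
  have fin: "finite A" "finite B" "finite C"
    using finite_subset[OF S(1)] by (auto simp: A_def B_def C_def)
  have sub: "N \<subseteq> A \<union> B \<union> C"
  proof
    fix s assume s: "s \<in> N"
    then have sG: "s \<in> S" "s \<noteq> e" "s \<in> arcs G" using S(1) by (auto simp: N_def)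
    note ext = tour_extendable_iff[OF MG(1) sG(3)] tour_extendable_iff[OF MG(2) sG(3)]
    show "s \<in> A \<union> B \<union> C"
    proof (cases "tail G s = tail G e \<or> head G s = head G e")
      case True
      then show ?thesis using sG by (auto simp: A_def B_def)
    next
      case False
      then have free: "tail G s \<notin> tail G ` ?M'" "head G s \<notin> head G ` ?M'"
        using s ext by (auto simp: N_def)
      then obtain p where p: "cycle p" "set p \<subseteq> insert s ?M'" "s \<in> set p" "tail G ` set p \<noteq> verts G"
        using s ext by (auto simp: N_def)
      have "e \<in> set p"
      proof (rule ccontr)
        assume "e \<notin> set p"
        then have "set p \<subseteq> insert s M" using p(2) by auto
        then show False using s p ext by (auto simp: N_def)
      qed
      obtain u where u: "awalk u p u" using p(1) by (auto simp: cycle_def)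
      from \<open>s \<in> set p\<close> obtain q r where pq: "p = q @ s # r" by (meson split_list)
      \<comment> \<open>Start the cycle right after \<open>s\<close>; it then is a path of \<open>?M'\<close> to the tail of \<open>s\<close> on which
        \<open>e\<close> occurs.\<close>
      have c: "cas (head G s) (r @ q) (tail G s)"
      proof -
        have "cas u q (tail G s)" "cas (head G s) r u" using u by (auto simp: awalk_def pq)
        then show ?thesis using awlast_if_cas[of "head G s" r u] by simp
      qed
      have "distinct p" using p(1) by (auto simp: cycle_conv)
      then have rq: "set (r @ q) \<subseteq> ?M'" using p(2) pq by auto
      have "e \<in> set (r @ q)" using \<open>e \<in> set p\<close> sG(2) pq by auto
      then obtain q' r' where rq': "r @ q = q' @ e # r'" by (meson split_list)
      then have "cas (head G e) r' (tail G s)" using c by simp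
      moreover have "set r' \<subseteq> ?M'" using rq unfolding rq' by auto
      ultimately show ?thesis using cas_imp_rtrancl free sG(1) unfolding C_def by blast
    qed
  qed
  have cards: "card A \<le> 1" "card B \<le> 1" "card C \<le> 1"
  proof -
    show "card A \<le> 1" "card B \<le> 1"
      using S(2,3) card_le_Suc0_iff_eq[OF fin(1)] card_le_Suc0_iff_eq[OF fin(2)]
      by (auto simp: A_def B_def inj_on_def)
    have "s = t" if "s \<in> C" "t \<in> C" for s t
    proof -
      have "tail G s = tail G t"
        by (rule unique_reachable_sink[OF inj, where u = "head G e"])
          (use that in \<open>simp_all add: C_def\<close>)
      then show ?thesis using that S(2) by (auto simp: C_def inj_on_def)
    qed
    then show "card C \<le> 1" using card_le_Suc0_iff_eq[OF fin(3)] by auto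
  qed
  have "card N \<le> card (A \<union> B \<union> C)" using sub fin by (intro card_mono) auto
  also have "\<dots> \<le> card A + card B + card C"
    by (meson card_Un_le order_trans add_le_mono1)
  finally have le: "card N \<le> card A + card B + card C" .
  then show "card N \<le> 3" using cards by simp
  assume "e \<in> S"
  then have "A = {}" "B = {}" using S(2,3) by (auto simp: A_def B_def inj_on_def)
  then show "card N \<le> 1" using le cards by simp
qed

section \<open>Runs of the greedy algorithm\<close>

lemma greedy_state_invariant:
  assumes "greedy_state G w M C"
  shows "C \<subseteq> arcs G" "partial_tour M" "\<And>s. s \<in> arcs G - C \<Longrightarrow> \<not> tour_extendable G M s"
proof -
  have "C \<subseteq> arcs G \<and> partial_tour M \<and> (\<forall>s \<in> arcs G - C. \<not> tour_extendable G M s)"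
    using assms
  proof (induction rule: greedy_state.induct)
    case init
    have "\<not> cycle p" if "set p \<subseteq> {}" for p using that by (auto simp: cycle_def)
    then show ?case by (auto simp: partial_tour_def)
  next
    case (step M C e)
    then have e: "e \<in> C" "e \<in> arcs G" by (auto simp: is_arg_max_def)
    show ?case
    proof (cases "tour_extendable G M e")
      case True
      have M': "partial_tour (insert e M)" using partial_tour_insert step.IH e True by blast
      then have M'G: "insert e M \<subseteq> arcs G" by (simp add: partial_tour_def)
      have "\<not> tour_extendable G (insert e M) e"
        using tour_extendable_iff[OF M'G e(2)] by auto
      moreover have "\<not> tour_extendable G (insert e M) s" if "s \<in> arcs G - C" for s
        using that step.IH tour_extendable_antimono[OF _ M'G] by blast
      ultimately show ?thesis using True M' step.IH by auto
    next
      case False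
      then show ?thesis using step.IH by auto
    qed
  qed
  then show "C \<subseteq> arcs G" "partial_tour M" "\<And>s. s \<in> arcs G - C \<Longrightarrow> \<not> tour_extendable G M s"
    by auto
qed

lemma greedy_potential:
  assumes nonneg: "\<And>S. S \<subseteq> arcs G \<Longrightarrow> w S \<ge> 0"
    and mono: "mono_on (Pow (arcs G)) w"
    and submod: "submodular_on (arcs G) w"
    and kappa: "0 \<le> \<kappa>" "\<kappa> \<le> 1"
    and curv: "has_curvature_on (arcs G) w \<kappa>"
    and S: "S \<subseteq> arcs G" "inj_on (tail G) S" "inj_on (head G) S"
    and "greedy_state G w M C"
  shows "w M + (\<Sum>s | s \<in> S - M \<and> \<not> tour_extendable G M s. marginal w M s) + w S - w (S \<union> M)
    \<le> (3 + \<kappa>) * w M"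
  using assms(10)
proof (induction rule: greedy_state.induct)
  case init
  \<comment> \<open>There are no loops, so the empty partial tour blocks nothing.\<close>
  have "tour_extendable G {} s" if "s \<in> S" for s
  proof -
    have s: "s \<in> arcs G" using that S(1) by auto
    have "\<not> (cycle p \<and> set p \<subseteq> {s} \<and> s \<in> set p)" for p
    proof
      assume p: "cycle p \<and> set p \<subseteq> {s} \<and> s \<in> set p"
      then have "set p = {s}" by auto
      then have "tail G s = head G s" using cycle_inj(3)[of p] p by auto
      then show False using no_loops[OF s] by simp
    qed
    then show ?thesis using tour_extendable_iff[OF _ s, of "{}"] by auto
  qed
  then have none: "{s. s \<in> S - {} \<and> \<not> tour_extendable G {} s} = {}" by auto
  show ?case unfolding none
    using mult_right_mono[of 1 "3 + \<kappa>" "w {}"] nonneg[of "{}"] kappa(1) by simp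
next
  case (step M C e)
  show ?case
  proof (cases "tour_extendable G M e")
    case False
    then show ?thesis using step.IH by simp
  next
    case True
    note inv = greedy_state_invariant[OF step.hyps(1)]
    have e: "e \<in> C" "e \<in> arcs G" and max: "\<And>s. s \<in> C \<Longrightarrow> marginal w M s \<le> marginal w M e"
      using step.hyps(3) inv(1) by (auto simp: is_arg_max_def not_less)
    have MG: "M \<subseteq> arcs G" using inv(2) by (simp add: partial_tour_def)
    have M': "partial_tour (insert e M)" using partial_tour_insert[OF inv(2) e(2) True] .
    then have M'G: "insert e M \<subseteq> arcs G" by (simp add: partial_tour_def)
    have eM: "e \<notin> M" using True tour_extendable_iff[OF MG e(2)] by auto
    define \<rho> where "\<rho> = marginal w M e"
    have \<rho>: "0 \<le> \<rho>" using marginal_nonneg[OF mono MG e(2)] by (simp add: \<rho>_def)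
    have wM': "w (insert e M) = w M + \<rho>" by (simp add: \<rho>_def marginal_def)
    define B where "B = {s. s \<in> S - M \<and> \<not> tour_extendable G M s}"
    define B' where "B' = {s. s \<in> S - insert e M \<and> \<not> tour_extendable G (insert e M) s}"
    define N where
      "N = {s \<in> S - insert e M. tour_extendable G M s \<and> \<not> tour_extendable G (insert e M) s}"
    have fin: "finite B" "finite N" "finite B'"
      using finite_subset[OF S(1)] by (auto simp: B_def N_def B'_def)
    have disj: "B \<inter> N = {}" "B' \<subseteq> B \<union> N" by (auto simp: B_def N_def B'_def)
    have BG: "B \<subseteq> arcs G" "N \<subseteq> arcs G" using S(1) by (auto simp: B_def N_def)
    have anti: "marginal w (insert e M) s \<le> marginal w M s" if "s \<in> arcs G" for s
      using marginal_antimono[OF mono submod _ M'G that, of M] by auto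
    have newly: "marginal w (insert e M) s \<le> \<rho>" if "s \<in> N" for s
    proof -
      have "s \<in> C" using that inv(3) BG(2) by (auto simp: N_def)
      then show ?thesis using max anti[of s] BG(2) that by (force simp: \<rho>_def)
    qed
    have "(\<Sum>s\<in>B'. marginal w (insert e M) s) \<le> (\<Sum>s\<in>B \<union> N. marginal w (insert e M) s)"
      using fin disj(2) BG marginal_nonneg[OF mono M'G] by (intro sum_mono2) auto
    also have "\<dots> = (\<Sum>s\<in>B. marginal w (insert e M) s) + (\<Sum>s\<in>N. marginal w (insert e M) s)"
      using fin disj(1) by (simp add: sum.union_disjoint)
    also have "\<dots> \<le> (\<Sum>s\<in>B. marginal w M s) + of_nat (card N) * \<rho>"
      using BG(1) by (intro add_mono sum_mono sum_bounded_above anti newly) auto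
    finally have sums: "(\<Sum>s\<in>B'. marginal w (insert e M) s)
        \<le> (\<Sum>s\<in>B. marginal w M s) + real (card N) * \<rho>" by simp
    have IH: "w M + (\<Sum>s\<in>B. marginal w M s) + w S - w (S \<union> M) \<le> (3 + \<kappa>) * w M"
      using step.IH by (simp add: B_def)
    have "w (insert e M) + (\<Sum>s\<in>B'. marginal w (insert e M) s) + w S - w (S \<union> insert e M)
        \<le> (3 + \<kappa>) * w (insert e M)"
    proof (cases "e \<in> S")
      case True
      then have "card N \<le> 1"
        using card_newly_blocked(2)[OF M' S] by (simp add: N_def)
      then have "real (card N) * \<rho> \<le> 1 * \<rho>" using \<rho> by (intro mult_right_mono) auto
      moreover have "S \<union> insert e M = S \<union> M" using True by auto
      moreover have "0 \<le> \<kappa> * \<rho>" using kappa(1) \<rho> by simp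
      ultimately show ?thesis using IH sums \<rho> wM' by (simp add: algebra_simps)
    next
      case False
      have "card N \<le> 3" using card_newly_blocked(1)[OF M' S] by (simp add: N_def)
      then have "real (card N) * \<rho> \<le> 3 * \<rho>" using \<rho> by (intro mult_right_mono) auto
      moreover have "w (S \<union> insert e M) - w (S \<union> M) \<ge> (1 - \<kappa>) * \<rho>"
      proof -
        have "\<rho> \<le> marginal w {} e"
          using marginal_antimono[OF mono submod _ MG e(2), of "{}"] by (simp add: \<rho>_def)
        also have "\<dots> \<le> w {e}" using nonneg[of "{}"] by (simp add: marginal_def)
        finally have "(1 - \<kappa>) * \<rho> \<le> (1 - \<kappa>) * w {e}" using kappa(2) by (intro mult_left_mono) auto
        also have "\<dots> \<le> marginal w (S \<union> M) e"
          using curv S(1) MG e(2) False eM unfolding has_curvature_on_def by auto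
        finally show ?thesis by (simp add: marginal_def)
      qed
      ultimately show ?thesis using IH sums wM' by (simp add: algebra_simps)
    qed
    then show ?thesis using True by (simp add: B'_def)
  qed
qed

end

section \<open>The approximation guarantee\<close>

theorem mainTheorem4:
  fixes G :: "('a, 'b) pre_digraph" and w :: "'b set \<Rightarrow> real" and \<kappa> :: real and n :: nat
    and M :: "'b set"
  assumes "complete_digraph n G" and "n \<ge> 2"
    and "\<And>S. S \<subseteq> arcs G \<Longrightarrow> w S \<ge> 0"
    and "mono_on (Pow (arcs G)) w"
    and "submodular_on (arcs G) w"
    and "0 \<le> \<kappa>" and "\<kappa> \<le> 1"
    and "has_curvature_on (arcs G) w \<kappa>"
    and "greedy_output G w M"
  shows "M \<in> hamiltonian_cycles G \<and>
         w M \<ge> 1 / (3 + \<kappa>) * Max (w ` hamiltonian_cycles G)"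
proof -
  interpret graph G using assms(1) by (simp add: complete_digraph_def)
  have n: "card (verts G) = n"
    and complete: "arcs_ends G = {(u, v). (u, v) \<in> verts G \<times> verts G \<and> u \<noteq> v}"
    using assms(1) by (auto simp: complete_digraph_def)
  obtain C where C: "greedy_state G w M C" "\<not> greedy_running G M C"
    using assms(9) by (auto simp: greedy_output_def)
  note inv = greedy_state_invariant[OF C(1)]
  have "card (verts G) \<le> card M"
  proof (cases "C = {}")
    case True
    then show ?thesis
      using maximal_partial_tour_card[OF complete _ inv(2)] inv(3) n assms(2) by auto
  next
    case False
    then show ?thesis using C(2) by (auto simp: greedy_running_def)
  qed
  moreover have "verts G \<noteq> {}" using n assms(2) by auto
  ultimately have M: "M \<in> hamiltonian_cycles G"
    using full_partial_tour_hamiltonian[OF inv(2)] by blast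
  have MG: "M \<subseteq> arcs G" using inv(2) by (simp add: partial_tour_def)
  have bound: "w S \<le> (3 + \<kappa>) * w M" if S: "S \<in> hamiltonian_cycles G" for S
  proof -
    obtain p where p: "cycle p" "S = set p"
      using S by (auto simp: hamiltonian_cycles_def hamiltonian_cycle_def)
    have SG: "S \<subseteq> arcs G" using p cycle_arcs by auto
    have "{s. s \<in> S - M \<and> \<not> tour_extendable G M s} = S - M"
      using hamiltonian_cycle_not_extendable[OF M] SG by auto
    then have "w M + (\<Sum>s\<in>S - M. marginal w M s) + w S - w (S \<union> M) \<le> (3 + \<kappa>) * w M"
      using greedy_potential[OF assms(3-8) SG _ _ C(1)] cycle_inj(1,2)[OF p(1)] p(2) by simp
    moreover have "w (M \<union> (S - M)) \<le> w M + (\<Sum>s\<in>S - M. marginal w M s)"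
      using SG p(2) by (intro submodular_union_le[OF assms(4,5) MG]) auto
    moreover have "M \<union> (S - M) = S \<union> M" by auto
    ultimately show ?thesis by simp
  qed
  have "hamiltonian_cycles G \<subseteq> Pow (arcs G)"
    using cycle_arcs by (auto simp: hamiltonian_cycles_def hamiltonian_cycle_def)
  then have "finite (hamiltonian_cycles G)" by (rule finite_subset) simp
  then have "Max (w ` hamiltonian_cycles G) \<le> (3 + \<kappa>) * w M" using M bound by (intro Max.boundedI) auto
  then show ?thesis using M assms(6) by (simp add: field_simps)
qed

end
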